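(* Let $\epsilon_1,\epsilon_2\geq0$ and let the perturbation probabilities of the mechanism PCKV-GRR be $$a=\frac{e^{\epsilon_1}}{e^{\epsilon_1}+d'-1},\qquad b=\frac{1}{e^{\epsilon_1}+d'-1},\qquad p=\frac{e^{\epsilon_2}}{e^{\epsilon_2}+1}.$$ Then PCKV-GRR satisfies $\epsilon$-LDP with $$\epsilon=\ln\left(\frac{e^{\epsilon_1+\epsilon_2}+\lambda}{\min\{e^{\epsilon_1},(e^{\epsilon_2}+1)/2\}+\lambda}\right),\qquad \lambda=\frac{(\ell-1)(e^{\epsilon_2}+1)}{2}.$$
   Context: **Data.** Let $d,\ell\geq1$ be integers ($\ell$ is the padding length), $\mathcal K=\{1,\dots,d\}$, $d'=d+\ell$, $\mathcal K'=\{1,\dots,d'\}$. An input is a nonempty finite set $\mathcal S$ of key-value pairs $\langle i,v_i^*\rangle$ with distinct keys $i\in\mathcal K$ and values $v_i^*\in[-1,1]$. The keys $d+1,\dots,d'$ are dummy keys. **Local differential privacy.** A randomized mechanism $\mathcal M$ satisfies $\epsilon$-LDP if for every pair of inputs $x,x'$ and every output $y$, $\Pr(\mathcal M(x)=y)\leq e^{\epsilon}\Pr(\mathcal M(x')=y)$. Here inputs range over all key-value sets $\mathcal S$. **Padding-and-Sampling.** Given $\mathcal S$, let $\eta=\frac{|\mathcal S|}{\max\{|\mathcal S|,\ell\}}$ and draw $B\sim\mathrm{Bernoulli}(\eta)$. If $B=1$, draw $\langle k,v^*\rangle$ uniformly from $\mathcal S$; if $B=0$, set $v^*=0$ and draw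 $k$ uniformly from $\{d+1,\dots,d'\}$. Then set $v=1$ with probability $\frac{1+v^*}{2}$ and $v=-1$ with probability $\frac{1-v^*}{2}$. Return $\langle k,v\rangle$. **PCKV-GRR** (parameters $a,p$, with $b=\frac{1-a}{d'-1}$). Given $\mathcal S$, obtain $\langle k,v\rangle$ by Padding-and-Sampling. Output a random pair $\langle k',v'\rangle\in\mathcal K'\times\{1,-1\}$ which equals $\langle k,v\rangle$ with probability $ap$, $\langle k,-v\rangle$ with probability $a(1-p)$, and, for each $i\in\mathcal K'\setminus\{k\}$, equals $\langle i,1\rangle$ with probability $b/2$ and $\langle i,-1\rangle$ with probability $b/2$. *)

theory Defs
  imports "HOL-Probability.Probability"
begin

definition ldp :: "real \<Rightarrow> 'x set \<Rightarrow> ('x \<Rightarrow> 'y pmf) \<Rightarrow> bool" where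
  "ldp \<epsilon> X M \<longleftrightarrow> (\<forall>x\<in>X. \<forall>x'\<in>X. \<forall>y. pmf (M x) y \<le> exp \<epsilon> * pmf (M x') y)"

definition kv_sets :: "nat \<Rightarrow> (nat \<times> real) set set" where
  "kv_sets d = {S. finite S \<and> S \<noteq> {} \<and> inj_on fst S \<and> S \<subseteq> {1..d} \<times> {-1..1}}"

text \<open>In the following, \<open>l\<close> is the padding length and \<open>{d+1..d+l}\<close> is the set of dummy keys.\<close>

definition padding_sampling :: "nat \<Rightarrow> nat \<Rightarrow> (nat \<times> real) set \<Rightarrow> (nat \<times> int) pmf" where
  "padding_sampling d l S = do {
     B \<leftarrow> bernoulli_pmf (real (card S) / real (max (card S) l));
     (k, u) \<leftarrow> (if B then pmf_of_set S else map_pmf (\<lambda>k. (k, 0)) (pmf_of_set {d+1..d+l}));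
     v \<leftarrow> map_pmf (\<lambda>c. if c then 1 else - 1) (bernoulli_pmf ((1 + u) / 2));
     return_pmf (k, v)
   }"

definition grr_weight :: "nat \<Rightarrow> real \<Rightarrow> real \<Rightarrow> real \<Rightarrow> nat \<times> int \<Rightarrow> nat \<times> int \<Rightarrow> real" where
  "grr_weight d' a b p = (\<lambda>(k, v) (k', v').
     if k' \<in> {1..d'} \<and> v' \<in> {1, -1}
     then if k' = k then (if v' = v then a * p else a * (1 - p)) else b / 2
     else 0)"

text \<open>\<^const>\<open>embed_pmf\<close> is only meaningful if the weights are nonnegative and add up to 1.  For
  \<open>d' \<ge> 2\<close> the latter is the relation \<open>b = (1 - a) / (d' - 1)\<close>; see \<open>pmf_grr_perturb\<close>.\<close>

definition grr_perturb :: "nat \<Rightarrow> real \<Rightarrow> real \<Rightarrow> real \<Rightarrow> nat \<times> int \<Rightarrow> (nat \<times> int) pmf" where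
  "grr_perturb d' a b p kv = embed_pmf (grr_weight d' a b p kv)"

definition pckv_grr ::
  "nat \<Rightarrow> nat \<Rightarrow> real \<Rightarrow> real \<Rightarrow> real \<Rightarrow> (nat \<times> real) set \<Rightarrow> (nat \<times> int) pmf" where
  "pckv_grr d l a b p S = bind_pmf (padding_sampling d l S) (grr_perturb (d + l) a b p)"

lemma pmf_grr_perturb:
  assumes k: "k \<in> {1..d'}" and v: "v \<in> {1, -1}" and d': "d' \<ge> 2"
    and a: "0 \<le> a" "a \<le> 1" and b: "b = (1 - a) / (real d' - 1)" and p: "0 \<le> p" "p \<le> 1"
  shows "pmf (grr_perturb d' a b p (k, v)) kv' = grr_weight d' a b p (k, v) kv'"
proof -
  let ?w = "grr_weight d' a b p (k, v)"
  have b0: "0 \<le> b" using a d' by (simp add: b)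
  have nn: "0 \<le> ?w x" for x
    using a b0 p by (auto simp: grr_weight_def split: prod.splits)
  have row: "(\<Sum>v'\<in>{1,-1}. ?w (k', v')) = (if k' = k then a else b)" if "k' \<in> {1..d'}" for k'
    using that v by (auto simp: grr_weight_def algebra_simps)
  have "(\<Sum>x\<in>{1..d'} \<times> {1,-1}. ?w x) = (\<Sum>k'=1..d'. \<Sum>v'\<in>{1,-1}. ?w (k', v'))"
    by (simp only: sum.cartesian_product) simp
  also have "\<dots> = (\<Sum>k'=1..d'. if k' = k then a else b)"
    using row by (intro sum.cong) auto
  also have "\<dots> = a + (\<Sum>k'\<in>{1..d'} - {k}. b)"
    using k by (subst sum.remove[of _ k]) auto
  also have "\<dots> = 1"
    using k d' by (simp add: b of_nat_diff)
  finally have total: "(\<Sum>x\<in>{1..d'} \<times> {1,-1}. ?w x) = 1" .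
  have "(\<integral>\<^sup>+ x. ennreal (?w x) \<partial>count_space UNIV)
      = (\<integral>\<^sup>+ x. ennreal (?w x) * indicator ({1..d'} \<times> {1,-1}) x \<partial>count_space UNIV)"
    by (intro nn_integral_cong) (auto simp: grr_weight_def indicator_def split: if_splits)
  also have "\<dots> = (\<Sum>x\<in>{1..d'} \<times> {1,-1}. ennreal (?w x))"
    by (simp add: nn_integral_count_space_indicator[symmetric] nn_integral_count_space_finite)
  also have "\<dots> = 1"
    by (simp only: sum_ennreal[OF nn] total ennreal_1)
  finally have "(\<integral>\<^sup>+ x. ennreal (?w x) \<partial>count_space UNIV) = 1" .
  then show ?thesis
    unfolding grr_perturb_def using nn by (intro pmf_embed_pmf) auto
qed

lemma grr_b_eq:
  assumes "d' \<ge> 2"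
  shows "1 / (exp \<epsilon>\<^sub>1 + real d' - 1)
    = (1 - exp \<epsilon>\<^sub>1 / (exp \<epsilon>\<^sub>1 + real d' - 1)) / (real d' - 1)"
proof -
  define n where "n = real d' - 1"
  have n: "n > 0" using assms by (simp add: n_def)
  then have pos: "exp \<epsilon>\<^sub>1 + n > 0" by (simp add: add_pos_pos)
  then have "1 - exp \<epsilon>\<^sub>1 / (exp \<epsilon>\<^sub>1 + n) = n / (exp \<epsilon>\<^sub>1 + n)" by (simp add: field_simps)
  then have "1 / (exp \<epsilon>\<^sub>1 + n) = (1 - exp \<epsilon>\<^sub>1 / (exp \<epsilon>\<^sub>1 + n)) / n" using n by simp
  then show ?thesis by (simp add: n_def add_diff_eq)
qed

end

theory Submission
  imports Defs
begin

text \<open>The output probability at \<open>(k, v)\<close> depends on the input only through the probabilities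
  \<open>P\<close> and \<open>Q\<close> that Padding-and-Sampling returns \<open>(k, v)\<close> and \<open>(k, - v)\<close>: up to a common factor it is
  \<open>h + P (e\<^sub>1 e\<^sub>2 - h) + Q (e\<^sub>1 - h)\<close> with \<open>e\<^sub>i = exp \<epsilon>\<^sub>i\<close> and \<open>h = (e\<^sub>2 + 1) / 2\<close>.
  Every key, genuine or dummy, is sampled with probability at most \<open>1 / l\<close>, i.e. \<open>P + Q \<le> 1 / l\<close>.
  As \<open>e\<^sub>1 e\<^sub>2 \<ge> max h e\<^sub>1\<close>, this puts the expression between
  \<open>h + min (e\<^sub>1 - h) 0 / l\<close> and \<open>h + (e\<^sub>1 e\<^sub>2 - h) / l\<close>, whose quotient is \<open>exp \<epsilon>\<close>.\<close>

text \<open>A key of \<open>S\<close> has probability \<open>\<eta> / card S\<close>, which is 1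
  over the maximum of \<open>card S\<close> and \<open>l\<close>; a dummy key has probability
  \<open>(1 - \<eta>) / l\<close>. Both are at most \<open>1 / l\<close>, and no key is of both
  sorts.\<close>

lemma pmf_map_fst_padding_sampling_le:
  assumes S: "S \<in> kv_sets d" and l: "l \<ge> 1"
  shows "pmf (map_pmf fst (padding_sampling d l S)) k \<le> 1 / real l"
proof -
  let ?m = "real (max (card S) l)" and ?D = "{d+1..d+l}"
  define \<eta> where "\<eta> = real (card S) / ?m"
  have fin: "finite S" "S \<noteq> {}" and inj: "inj_on fst S" and keys: "fst ` S \<subseteq> {1..d}"
    using S by (auto simp: kv_sets_def)
  have n: "card S > 0" using fin by (simp add: card_gt_0_iff)
  have m: "?m \<ge> real l" "?m \<ge> real (card S)" by auto
  have \<eta>: "0 \<le> \<eta>" "\<eta> \<le> 1" using n by (auto simp: \<eta>_def field_simps)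
  have D: "?D \<noteq> {}" using l by auto
  \<comment> \<open>\<open>fst\<close> discards the randomised value, and since the keys in
    \<open>S\<close> are distinct, a uniform pair has a uniform key.\<close>
  have "map_pmf fst (padding_sampling d l S) = bind_pmf (bernoulli_pmf \<eta>)
      (\<lambda>B. map_pmf fst (if B then pmf_of_set S else map_pmf (\<lambda>k. (k, 0)) (pmf_of_set ?D)))"
    by (simp add: padding_sampling_def \<eta>_def map_bind_pmf bind_map_pmf case_prod_beta
        map_pmf_def[of fst])
  also have "\<dots> = bind_pmf (bernoulli_pmf \<eta>)
      (\<lambda>B. if B then pmf_of_set (fst ` S) else pmf_of_set ?D)"
    by (intro bind_pmf_cong refl) (simp add: map_pmf_of_set_inj[OF inj fin(2,1)] pmf.map_comp o_def)
  finally have "pmf (map_pmf fst (padding_sampling d l S)) k =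
      \<eta> * (indicator (fst ` S) k / card S) + (1 - \<eta>) * (indicator ?D k / l)"
    using \<eta> fin D by (simp add: pmf_bind card_image[OF inj] mult.commute)
  also have "\<dots> \<le> 1 / l"
  proof (cases "k \<in> fst ` S")
    case True
    then have "k \<notin> ?D" using keys by auto
    moreover have "\<eta> / card S = 1 / ?m" using n by (simp add: \<eta>_def)
    moreover have "1 / ?m \<le> 1 / l" using m l by (intro divide_left_mono) auto
    ultimately show ?thesis using True by simp
  next
    case False
    then show ?thesis using \<eta> l by (auto simp: indicator_def divide_simps)
  qed
  finally show ?thesis .
qed

text \<open>Supplies the range conditions on the sampled pair under which
  \<open>pmf_grr_perturb\<close> identifies \<open>grr_perturb\<close> with its weights.\<close>

lemma set_padding_sampling:
  assumes S: "S \<in> kv_sets d" and l: "l \<ge> 1"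
  shows "set_pmf (padding_sampling d l S) \<subseteq> {1..d+l} \<times> {1, -1}"
proof -
  have "set_pmf (pmf_of_set S) = S" and keys: "\<And>i u. (i, u) \<in> S \<Longrightarrow> i \<in> {1..d}"
    using S by (auto simp: kv_sets_def)
  moreover have "set_pmf (pmf_of_set {d+1..d+l}) = {d+1..d+l}" using l by simp
  ultimately show ?thesis
    by (auto simp: padding_sampling_def split: if_splits dest!: keys)
qed

text \<open>Given the sampled pair, the output \<open>(k, v)\<close> has the baseline probability
  \<open>b / 2\<close> except when that pair is \<open>(k, v)\<close> or \<open>(k, - v)\<close>.
  Each exception adds a correction on a single atom, and averaging turns the atoms into their
  probabilities.\<close>

lemma pmf_pckv_grr:
  assumes S: "S \<in> kv_sets d" and l: "l \<ge> 1" and d': "d + l \<ge> 2"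
    and a: "0 \<le> a" "a \<le> 1" and b: "b = (1 - a) / (real (d + l) - 1)" and p: "0 \<le> p" "p \<le> 1"
    and k: "k \<in> {1..d+l}" and v: "v \<in> {1, -1}"
  shows "pmf (pckv_grr d l a b p S) (k, v) =
    b / 2 + pmf (padding_sampling d l S) (k, v) * (a * p - b / 2)
          + pmf (padding_sampling d l S) (k, - v) * (a * (1 - p) - b / 2)"
proof -
  let ?N = "padding_sampling d l S"
  have "pmf (pckv_grr d l a b p S) (k, v) =
      (\<integral>x. pmf (grr_perturb (d + l) a b p x) (k, v) \<partial>measure_pmf ?N)"
    by (simp add: pckv_grr_def pmf_bind)
  also have "\<dots> = (\<integral>x. b / 2 + (indicator {(k, v)} x * (a * p - b / 2)
      + indicator {(k, - v)} x * (a * (1 - p) - b / 2)) \<partial>measure_pmf ?N)"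
  proof (intro integral_cong_AE)
    show "AE x in measure_pmf ?N. pmf (grr_perturb (d + l) a b p x) (k, v) =
        b / 2 + (indicator {(k, v)} x * (a * p - b / 2)
          + indicator {(k, - v)} x * (a * (1 - p) - b / 2))"
      unfolding AE_measure_pmf_iff
    proof
      fix x assume x_in: "x \<in> set_pmf ?N"
      then obtain i w where x: "x = (i, w)" "i \<in> {1..d+l}" "w \<in> {1, -1}"
        using set_padding_sampling[OF S l] x_in by blast
      have "pmf (grr_perturb (d + l) a b p x) (k, v) = grr_weight (d + l) a b p (i, w) (k, v)"
        unfolding x(1) using x(2,3) d' a b p by (rule pmf_grr_perturb)
      also have "\<dots> = b / 2 + (indicator {(k, v)} x * (a * p - b / 2)
          + indicator {(k, - v)} x * (a * (1 - p) - b / 2))"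
        using x k v by (auto simp: grr_weight_def indicator_def)
      finally show "pmf (grr_perturb (d + l) a b p x) (k, v) =
        b / 2 + (indicator {(k, v)} x * (a * p - b / 2)
          + indicator {(k, - v)} x * (a * (1 - p) - b / 2))" .
    qed
  qed auto
  also have "\<dots> = b / 2 + (pmf ?N (k, v) * (a * p - b / 2)
      + pmf ?N (k, - v) * (a * (1 - p) - b / 2))"
    by (simp add: measure_pmf.integrable_const_bound[where B=1] measure_pmf_single)
  finally show ?thesis by simp
qed

text \<open>\<open>ldp\<close> quantifies over the whole output type, so outputs outside the range
  need a case of their own.\<close>

lemma pmf_pckv_grr_eq_0:
  assumes S: "S \<in> kv_sets d" and l: "l \<ge> 1" and d': "d + l \<ge> 2"
    and a: "0 \<le> a" "a \<le> 1" and b: "b = (1 - a) / (real (d + l) - 1)" and p: "0 \<le> p" "p \<le> 1"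
    and y: "y \<notin> {1..d+l} \<times> {1, -1}"
  shows "pmf (pckv_grr d l a b p S) y = 0"
proof -
  have "pmf (grr_perturb (d + l) a b p x) y = 0" if x_in: "x \<in> set_pmf (padding_sampling d l S)" for x
  proof -
    obtain i w where x: "x = (i, w)" "i \<in> {1..d+l}" "w \<in> {1, -1}"
      using set_padding_sampling[OF S l] x_in by blast
    have "pmf (grr_perturb (d + l) a b p x) y = grr_weight (d + l) a b p (i, w) y"
      unfolding x(1) using x(2,3) d' a b p by (rule pmf_grr_perturb)
    then show ?thesis using y by (auto simp: grr_weight_def split: prod.splits)
  qed
  then show ?thesis
    unfolding pckv_grr_def by (auto simp: pmf_eq_0_set_pmf)
qed

text \<open>As \<open>v\<close> is nonzero, the two pairs are distinct atoms inside the event that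
  key \<open>k\<close> is sampled.\<close>

lemma pmf_padding_sampling_add_le:
  assumes "S \<in> kv_sets d" and "l \<ge> 1" and v: "v \<in> {1, -1}"
  shows "pmf (padding_sampling d l S) (k, v) + pmf (padding_sampling d l S) (k, - v) \<le> 1 / real l"
proof -
  let ?N = "padding_sampling d l S"
  have "pmf ?N (k, v) + pmf ?N (k, - v) = measure ?N {(k, v), (k, - v)}"
    using v by (subst measure_measure_pmf_finite) auto
  also have "\<dots> \<le> measure ?N (fst -` {k})"
    by (intro measure_pmf.finite_measure_mono) auto
  also have "\<dots> = pmf (map_pmf fst ?N) k"
    by (simp add: pmf_map)
  also have "\<dots> \<le> 1 / l"
    using assms by (intro pmf_map_fst_padding_sampling_le)
  finally show ?thesis .
qed

text \<open>The extreme case puts all of the mass \<open>r\<close> on \<open>A - h\<close>, the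
  larger coefficient, which is nonnegative.\<close>

lemma affine_upper_bound:
  fixes P Q r A B h :: real
  assumes "0 \<le> Q" "P + Q \<le> r" "h \<le> A" "B \<le> A"
  shows "h + P * (A - h) + Q * (B - h) \<le> h + r * (A - h)"
proof -
  have "Q * (B - h) \<le> Q * (A - h)"
    using assms by (intro mult_left_mono) auto
  moreover have "(P + Q) * (A - h) \<le> r * (A - h)"
    using assms by (intro mult_right_mono) auto
  ultimately show ?thesis by (simp add: algebra_simps)
qed

lemma affine_lower_bound:
  fixes P Q r A B h :: real
  assumes "0 \<le> P" "0 \<le> Q" "P + Q \<le> r" "h \<le> A"
  shows "h + r * (min B h - h) \<le> h + P * (A - h) + Q * (B - h)"
proof -
  have "r * (min B h - h) \<le> Q * (min B h - h)"
    using assms by (intro mult_right_mono_neg) auto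
  also have "\<dots> \<le> Q * (B - h)"
    using assms by (intro mult_left_mono) auto
  finally show ?thesis using assms mult_nonneg_nonneg[of P "A - h"] by linarith
qed

theorem theorem3:
  fixes d l :: nat and \<epsilon>\<^sub>1 \<epsilon>\<^sub>2 a b p lam \<epsilon> :: real
  assumes "d \<ge> 1" and "l \<ge> 1"
    and "\<epsilon>\<^sub>1 \<ge> 0" and "\<epsilon>\<^sub>2 \<ge> 0"
    and "a = exp \<epsilon>\<^sub>1 / (exp \<epsilon>\<^sub>1 + real (d + l) - 1)"
    and "b = 1 / (exp \<epsilon>\<^sub>1 + real (d + l) - 1)"
    and "p = exp \<epsilon>\<^sub>2 / (exp \<epsilon>\<^sub>2 + 1)"
    and "lam = (real l - 1) * (exp \<epsilon>\<^sub>2 + 1) / 2"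
    and "\<epsilon> = ln ((exp (\<epsilon>\<^sub>1 + \<epsilon>\<^sub>2) + lam) / (min (exp \<epsilon>\<^sub>1) ((exp \<epsilon>\<^sub>2 + 1) / 2) + lam))"
  shows "ldp \<epsilon> (kv_sets d) (pckv_grr d l a b p)"
proof -
  define e1 e2 h where "e1 = exp \<epsilon>\<^sub>1" and "e2 = exp \<epsilon>\<^sub>2" and "h = (exp \<epsilon>\<^sub>2 + 1) / 2"
  \<comment> \<open>This scaling turns \<open>b / 2\<close>, \<open>a * p\<close> and
    \<open>a * (1 - p)\<close> into \<open>c\<close> times \<open>h\<close>, \<open>e1 * e2\<close>
    and \<open>e1\<close>; the positive factor \<open>c\<close> cancels when two inputs are
    compared.\<close>
  define c where "c = b / (2 * h)"
  let ?U = "e1 * e2 + lam" and ?L = "min e1 h + lam"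
  have l: "real l \<ge> 1" and d': "d + l \<ge> 2" using assms(1,2) by auto
  have e: "e1 \<ge> 1" "e2 \<ge> 1" using assms(3,4) by (auto simp: e1_def e2_def)
  have h2: "2 * h = e2 + 1" by (simp add: h_def e2_def)
  then have h: "h > 0" "h \<le> e2" "e2 = 2 * h - 1" using e by linarith+
  \<comment> \<open>Nonnegative privacy budgets put \<open>e1 * e2\<close> above both
    \<open>e1\<close> and \<open>h\<close>, as \<open>affine_upper_bound\<close> requires of its
    \<open>A\<close>.\<close>
  have e12: "e1 \<le> e1 * e2" "e2 \<le> e1 * e2"
    using e by (auto simp: mult_le_cancel_left1 mult_le_cancel_right1)
  have he: "h \<le> e1 * e2" using e12(2) h(2) by linarith
  have Z: "e1 + real (d + l) - 1 > 0" using e d' by linarith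
  have ab: "a = e1 * b" and b0: "b > 0"
    using assms(5,6) Z by (auto simp: e1_def)
  have a01: "0 \<le> a" "a \<le> 1"
    using assms(5) Z d' e by (auto simp: e1_def)
  have b': "b = (1 - a) / (real (d + l) - 1)"
    unfolding assms(5,6) by (rule grr_b_eq[OF d'])
  have p': "p = e2 / (2 * h)" unfolding h2 by (simp add: assms(7) e2_def)
  have q': "1 - p = 1 / (2 * h)" using h(1) unfolding p' h(3) by (simp add: diff_divide_distrib)
  have p01: "0 \<le> p" "p \<le> 1" using e h by (auto simp: p' field_simps)
  have c: "c > 0" using b0 h by (simp add: c_def)
  have weights: "b / 2 = c * h" "a * p = c * (e1 * e2)" "a * (1 - p) = c * e1"
    using h(1) unfolding q' unfolding p' c_def ab by simp_all
  \<comment> \<open>In this form \<open>h + (X - h) / l = (X + lam) / l\<close>, so the extreme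
    values of the affine expression become \<open>?U / l\<close> and \<open>?L / l\<close>.\<close>
  have lam: "lam = (real l - 1) * h" "lam \<ge> 0"
    using l h by (auto simp: assms(8) h_def)
  have L: "?L > 0" using e h lam by linarith
  have U: "?U > 0" using e12 e lam by linarith
  have "exp \<epsilon> = ?U / ?L"
    using L U by (simp add: assms(9) e1_def e2_def h_def exp_add)
  then have expL: "exp \<epsilon> * ?L = ?U" using L by simp
  have "pmf (pckv_grr d l a b p S) y \<le> exp \<epsilon> * pmf (pckv_grr d l a b p S') y"
    if S: "S \<in> kv_sets d" and S': "S' \<in> kv_sets d" for S S' y
  proof (cases "y \<in> {1..d+l} \<times> {1, -1}")
    case False
    then show ?thesis
      using pmf_pckv_grr_eq_0[OF _ assms(2) d' a01 b' p01] S by simp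
  next
    case True
    then obtain k v where y: "y = (k, v)" "k \<in> {1..d+l}" "v \<in> {1, -1}" by blast
    define P where "P T = pmf (padding_sampling d l T) (k, v)" for T
    define Q where "Q T = pmf (padding_sampling d l T) (k, - v)" for T
    have eq: "pmf (pckv_grr d l a b p T) y = c * (h + P T * (e1 * e2 - h) + Q T * (e1 - h))"
      if "T \<in> kv_sets d" for T
      unfolding y(1) pmf_pckv_grr[OF that assms(2) d' a01 b' p01 y(2,3)] weights P_def Q_def
      by (simp add: algebra_simps)
    have PQ: "P T + Q T \<le> 1 / l" "P T \<ge> 0" "Q T \<ge> 0" if "T \<in> kv_sets d" for T
      unfolding P_def Q_def using pmf_padding_sampling_add_le[OF that assms(2) y(3)] by auto
    \<comment> \<open>The upper bound for \<open>S\<close> equals \<open>exp \<epsilon>\<close>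
      times the lower bound for \<open>S'\<close>, since the common divisor \<open>l\<close> cancels
      in their quotient.\<close>
    have "h + P S * (e1 * e2 - h) + Q S * (e1 - h) \<le> h + 1 / l * (e1 * e2 - h)"
      using PQ[OF S] e12(1) he by (intro affine_upper_bound) auto
    also have "\<dots> = ?U / l" using l by (simp add: lam field_simps)
    also have "\<dots> = exp \<epsilon> * (?L / l)" by (simp add: expL)
    also have "?L / l = h + 1 / l * (min e1 h - h)" using l by (simp add: lam field_simps)
    also have "exp \<epsilon> * \<dots> \<le> exp \<epsilon> * (h + P S' * (e1 * e2 - h) + Q S' * (e1 - h))"
      using PQ[OF S'] e12(1) he by (intro mult_left_mono affine_lower_bound) auto
    finally show ?thesis
      using c by (simp add: eq S S')
  qed
  then show ?thesis by (simp add: ldp_def)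
qed

end
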